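(* Let $\Delta(0,2)=\{z\in\mathbb{C}: |z|<2\}$. There exists a sequence $\{f_n\}_{n=1}^\infty$ of holomorphic functions on $\Delta(0,2)$ such that $$\frac{|f_n''(z)|}{1+|f_n(z)|^{3}}\le 1\qquad\text{for every } n\ge 1 \text{ and every } z\in\Delta(0,2),$$ and such that $\{f_n\}_{n=1}^\infty$ is not a quasi-normal family in $\Delta(0,2)$.
   Context: A family $\mathcal{F}$ of functions meromorphic in a domain $D\subset\mathbb{C}$ is called quasi-normal in $D$ if every sequence of members of $\mathcal{F}$ has a subsequence for which there is a set $E\subset D$ (depending on the subsequence) having no accumulation point in $D$, such that the subsequence converges uniformly with respect to the spherical metric on compact subsets of $D\setminus E$ (the constant $\infty$ is allowed as a limit function). A sequence $\{f_n\}$ is called quasi-normal if the family consisting of its members is quasi-normal. *)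

theory Defs
  imports "HOL-Complex_Analysis.Complex_Analysis"
begin

datatype riemann_sphere = Fin complex | Infty

text \<open>Inverse stereographic projection onto the unit sphere of \<open>complex \<times> real\<close>,
  projecting from the north pole \<open>(0, 1)\<close>.\<close>

primrec stereo :: "riemann_sphere \<Rightarrow> complex \<times> real" where
  "stereo (Fin z) = ((2 / (1 + (norm z)\<^sup>2)) *\<^sub>R z, ((norm z)\<^sup>2 - 1) / ((norm z)\<^sup>2 + 1))"
| "stereo Infty = (0, 1)"

text \<open>The spherical metric is the great-circle distance on the unit sphere.\<close>

definition sph_dist :: "riemann_sphere \<Rightarrow> riemann_sphere \<Rightarrow> real" where
  "sph_dist p q = arccos (stereo p \<bullet> stereo q)"

lemma norm_stereo: "norm (stereo p) = 1"
proof (cases p)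
  case (Fin z)
  define t where "t = (norm z)\<^sup>2"
  have t: "1 + t > 0"
    unfolding t_def by (smt (verit) zero_le_power2)
  have "(norm (stereo p))\<^sup>2 = (2 / (1 + t))\<^sup>2 * t + ((t - 1) / (1 + t))\<^sup>2"
    using Fin by (simp add: norm_Pair power_mult_distrib power_divide t_def add.commute)
  also have "\<dots> = (4 * t + (t - 1)\<^sup>2) / (1 + t)\<^sup>2"
    by (simp add: power_divide add_divide_distrib)
  also have "4 * t + (t - 1)\<^sup>2 = (1 + t)\<^sup>2"
    by (simp add: power2_eq_square algebra_simps)
  finally have "(norm (stereo p))\<^sup>2 = 1"
    using t by simp
  then show ?thesis
    by (simp add: power2_eq_1_iff) (smt (verit) norm_ge_zero)
qed (simp add: norm_Pair)

lemma inj_stereo: "inj stereo"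
proof (rule injI)
  have pos: "1 + (norm z)\<^sup>2 > 0" for z :: complex
    by (smt (verit) zero_le_power2)
  have snd_stereo: "snd (stereo (Fin z)) = 1 - 2 / (1 + (norm z)\<^sup>2)" for z
    using pos[of z] by (simp add: field_simps)
  fix p q assume eq: "stereo p = stereo q"
  show "p = q"
  proof (cases p; cases q)
    fix z w assume pq: "p = Fin z" "q = Fin w"
    have *: "2 / (1 + (norm z)\<^sup>2) = 2 / (1 + (norm w)\<^sup>2)"
      using snd_stereo[of z] snd_stereo[of w] eq pq by simp
    have "(2 / (1 + (norm z)\<^sup>2)) *\<^sub>R z = (2 / (1 + (norm w)\<^sup>2)) *\<^sub>R w"
      using eq pq by simp
    then have "(2 / (1 + (norm w)\<^sup>2)) *\<^sub>R z = (2 / (1 + (norm w)\<^sup>2)) *\<^sub>R w"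
      unfolding * .
    moreover have "2 / (1 + (norm w)\<^sup>2) \<noteq> 0"
      using pos[of w] by simp
    ultimately show ?thesis
      using pq by (metis scaleR_left_imp_eq)
  next
    fix z assume "p = Fin z" "q = Infty"
    then show ?thesis
      using eq snd_stereo[of z] pos[of z] by simp
  next
    fix z assume "p = Infty" "q = Fin z"
    then show ?thesis
      using eq snd_stereo[of z] pos[of z] by simp
  qed simp
qed

lemma sph_dist_eq_0_iff: "sph_dist p q = 0 \<longleftrightarrow> p = q"
proof
  assume "sph_dist p q = 0"
  moreover have "\<bar>stereo p \<bullet> stereo q\<bar> \<le> 1"
    using Cauchy_Schwarz_ineq2[of "stereo p" "stereo q"] by (simp add: norm_stereo)
  ultimately have "stereo p \<bullet> stereo q = 1"
    unfolding sph_dist_def by (metis cos_arccos_abs cos_zero)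
  then have "(norm (stereo p - stereo q))\<^sup>2 = 0"
    by (simp add: norm_stereo power2_norm_eq_inner[symmetric] dot_norm_neg)
  then show "p = q"
    using inj_stereo by (simp add: inj_eq)
next
  assume "p = q"
  then show "sph_dist p q = 0"
    by (simp add: sph_dist_def norm_stereo power2_norm_eq_inner[symmetric] dot_square_norm)
qed

text \<open>A meromorphic function as a map into the sphere. The library represents it by a total
  function \<open>complex \<Rightarrow> complex\<close>, whose value at a pole is meaningless.\<close>

definition sph_val :: "(complex \<Rightarrow> complex) \<Rightarrow> complex \<Rightarrow> riemann_sphere" where
  "sph_val f z = (if is_pole f z then Infty else Fin (f z))"

text \<open>Locally uniform convergence in the spherical metric. The limit \<open>g\<close> is any
  sphere-valued function, in particular possibly the constant \<open>Infty\<close>.\<close>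

definition sph_converges_on ::
    "(nat \<Rightarrow> complex \<Rightarrow> complex) \<Rightarrow> complex set \<Rightarrow> bool" where
  "sph_converges_on f U \<longleftrightarrow>
     (\<exists>g. \<forall>K. compact K \<and> K \<subseteq> U \<longrightarrow>
        uniform_limit K (\<lambda>n z. sph_dist (sph_val (f n) z) (g z)) (\<lambda>_. 0) sequentially)"

text \<open>Intended for a domain \<open>D\<close> and a family \<open>F\<close> of functions that are
  \<open>nicely_meromorphic_on D\<close> (so that values off the poles are the right ones);
  functions holomorphic on \<open>D\<close> are of this kind.\<close>

definition quasi_normal :: "(complex \<Rightarrow> complex) set \<Rightarrow> complex set \<Rightarrow> bool" where
  "quasi_normal F D \<longleftrightarrow>
     (\<forall>s :: nat \<Rightarrow> complex \<Rightarrow> complex. range s \<subseteq> F \<longrightarrow>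
        (\<exists>r E. strict_mono r \<and> E \<subseteq> D \<and> (\<forall>z\<in>D. \<not> z islimpt E) \<and>
               sph_converges_on (s \<circ> r) (D - E)))"

end

(*
  The function g = sin * exp(sin^2 / 6) satisfies g'' = g^3 h for an entire h, because the exponent
  is chosen so that g'' vanishes to third order at every zero of g.  Hence
  f_n(z) = A_n g(n z) satisfies |f_n''| <= |f_n|^3 on the disc as soon as A_n^2 bounds
  n^2 |h(n z)| there.  On every real interval the zeros of f_n and the points where
  |sin(n z)| = 1, so that |f_n| >= 1, both become dense as n grows, so no subsequence
  converges spherically near any real point.
*)

theory Submission imports Defs begin

section \<open>The model function and its second derivative\<close>

text \<open>The constant 1/6 cancels the cubic Taylor coefficient -1/6 of \<open>sin\<close> at 0:
  near each zero \<open>p\<close> the function is \<plusminus>(w - p) up to terms of order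
  five.\<close>

definition sine_bump :: "complex \<Rightarrow> complex" where
  "sine_bump w = sin w * exp ((sin w)\<^sup>2 / 6)"

text \<open>This is the entire function \<open>h\<close> in g'' = g^3 h for g =
  \<open>sine_bump\<close>. The exponent is 1/6 - 3/6 = -1/3.\<close>

definition sine_bump_cofactor :: "complex \<Rightarrow> complex" where
  "sine_bump_cofactor w = ((cos w)\<^sup>2 / 9 - 4 / 3) * exp (- ((sin w)\<^sup>2 / 3))"

lemma has_field_derivative_sine_bump:
  "(sine_bump has_field_derivative
      cos w * exp ((sin w)\<^sup>2 / 6) * (1 + (sin w)\<^sup>2 / 3)) (at w)"
  unfolding sine_bump_def
  by (auto intro!: derivative_eq_intros simp: field_simps power2_eq_square)

lemma has_field_derivative_sine_bump2:
  "((\<lambda>w. cos w * exp ((sin w)\<^sup>2 / 6) * (1 + (sin w)\<^sup>2 / 3)) has_field_derivative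
      sine_bump w ^ 3 * sine_bump_cofactor w) (at w)"
proof -
  have exp_eq: "exp ((sin w)\<^sup>2 / 6) ^ 3 * exp (- ((sin w)\<^sup>2 / 3)) = exp ((sin w)\<^sup>2 / 6)"
    by (simp add: exp_of_nat_mult[symmetric] exp_add[symmetric])
  have "sine_bump w ^ 3 * sine_bump_cofactor w
      = sin w ^ 3 * ((cos w)\<^sup>2 / 9 - 4 / 3)
          * (exp ((sin w)\<^sup>2 / 6) ^ 3 * exp (- ((sin w)\<^sup>2 / 3)))"
    by (simp add: sine_bump_def sine_bump_cofactor_def power_mult_distrib mult_ac)
  also have "\<dots> = sin w ^ 3 * ((cos w)\<^sup>2 / 9 - 4 / 3) * exp ((sin w)\<^sup>2 / 6)"
    by (simp only: exp_eq)
  finally have eq: "sine_bump w ^ 3 * sine_bump_cofactor w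
      = sin w ^ 3 * ((cos w)\<^sup>2 / 9 - 4 / 3) * exp ((sin w)\<^sup>2 / 6)" .
  define E where "E = exp ((sin w)\<^sup>2 / 6)"
  have alg: "(- s * E + c * (E * (s * c / 3))) * (1 + s\<^sup>2 / 3) + c * E * (2 * s * c / 3)
      = s ^ 3 * (c\<^sup>2 / 9 - 4 / 3) * E" if "c\<^sup>2 = 1 - s\<^sup>2" for s c :: complex
  proof -
    have "(- s * E + c * (E * (s * c / 3))) * (1 + s\<^sup>2 / 3) + c * E * (2 * s * c / 3)
        = s * E * ((- 1 + c\<^sup>2 / 3) * (1 + s\<^sup>2 / 3) + 2 * c\<^sup>2 / 3)"
      by (simp add: field_simps power2_eq_square)
    \<comment> \<open>With \<open>c\<^sup>2 = 1 - s\<^sup>2\<close> the constant terms -2/3 and 2/3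
      in the bracket cancel, so it is divisible by \<open>s\<^sup>2\<close>. Any coefficient other
      than 1/6 in the exponent would leave a nonzero constant.\<close>
    also have "\<dots> = s ^ 3 * (c\<^sup>2 / 9 - 4 / 3) * E"
      unfolding that by (simp add: field_simps power2_eq_square power3_eq_cube)
    finally show ?thesis .
  qed
  have "((\<lambda>w. cos w * exp ((sin w)\<^sup>2 / 6) * (1 + (sin w)\<^sup>2 / 3)) has_field_derivative
      (- sin w * E + cos w * (E * (sin w * cos w / 3))) * (1 + (sin w)\<^sup>2 / 3)
      + cos w * E * (2 * sin w * cos w / 3)) (at w)"
    unfolding E_def
    by (auto intro!: derivative_eq_intros simp: field_simps power2_eq_square)
  then show ?thesis
    unfolding eq alg[OF cos_squared_eq] by (simp only: E_def)
qed

lemma deriv2_scaled_sine_bump: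
  "(deriv ^^ 2) (\<lambda>z. a * sine_bump (c * z)) z
     = a * c\<^sup>2 * (sine_bump (c * z) ^ 3 * sine_bump_cofactor (c * z))"
proof -
  have "deriv (\<lambda>z. a * sine_bump (c * z))
      = (\<lambda>z. a * c * (cos (c * z) * exp ((sin (c * z))\<^sup>2 / 6) * (1 + (sin (c * z))\<^sup>2 / 3)))"
    by (rule ext, rule DERIV_imp_deriv, rule DERIV_cong,
        rule DERIV_cmult[OF DERIV_chain2[OF has_field_derivative_sine_bump DERIV_cmult_Id]])
      simp
  moreover have "deriv \<dots> z = a * c\<^sup>2 * (sine_bump (c * z) ^ 3 * sine_bump_cofactor (c * z))"
    by (rule DERIV_imp_deriv, rule DERIV_cong,
        rule DERIV_cmult[OF DERIV_chain2[OF has_field_derivative_sine_bump2 DERIV_cmult_Id]])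
      (simp add: power2_eq_square)
  ultimately show ?thesis
    by (simp add: numeral_2_eq_2)
qed

lemma holomorphic_scaled_sine_bump: "(\<lambda>z. a * sine_bump (c * z)) holomorphic_on S"
  unfolding sine_bump_def by (intro holomorphic_intros) auto

section \<open>Choice of the amplitude; zeros and large values on the real axis\<close>

text \<open>The cofactor is continuous on the compact closed disc, hence bounded there. The bound is
  by \<open>a\<^sup>2\<close> because an amplitude \<open>a\<close> enters f'' once but |f|^3 three
  times.\<close>

lemma ex_sine_bump_scale:
  "\<exists>a::real. a \<ge> 1 \<and>
     (\<forall>z\<in>ball 0 R. norm (c\<^sup>2 * sine_bump_cofactor (c * z)) \<le> a\<^sup>2)"
proof -
  have "continuous_on (cball 0 R) (\<lambda>z. c\<^sup>2 * sine_bump_cofactor (c * z))"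
    unfolding sine_bump_cofactor_def by (intro continuous_intros) auto
  then have "bounded ((\<lambda>z. c\<^sup>2 * sine_bump_cofactor (c * z)) ` cball 0 R)"
    by (intro compact_imp_bounded compact_continuous_image) auto
  then obtain M where "\<forall>z\<in>cball 0 R. norm (c\<^sup>2 * sine_bump_cofactor (c * z)) \<le> M"
    and "M > 0"
    by (auto simp only: bounded_pos ball_simps)
  moreover have "M \<le> (1 + M)\<^sup>2"
    using \<open>M > 0\<close> by (simp add: power2_eq_square algebra_simps add_increasing2)
  \<comment> \<open>The witness 1 + M is at least 1 and its square dominates M.\<close>
  ultimately show ?thesis
    by (intro exI[of _ "1 + M"]) (auto intro: order_trans)
qed

lemma scaled_sine_bump_zero: "a * sine_bump (of_real (of_int k * pi)) = 0"
proof -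
  have "sin (complex_of_real (of_int k * pi)) = of_real (sin (of_int k * pi))"
    by (simp only: sin_of_real)
  then show ?thesis
    by (simp add: sine_bump_def sin_zero_iff_int2 del: of_real_mult)
qed

text \<open>At these points \<open>sin\<close> is 1 or -1, so the modulus is exactly
  \<open>a * exp (1 / 6)\<close>.\<close>

lemma norm_scaled_sine_bump_ge_1:
  assumes "a \<ge> 1"
  shows "norm (of_real a * sine_bump (of_real (of_int k * pi + pi / 2))) \<ge> 1"
proof -
  define s where "s = sin (of_int k * pi + pi / 2)"
  have "cos (of_int k * pi + pi / 2) = 0"
    by (simp add: cos_add sin_zero_iff_int2)
  then have "s\<^sup>2 = 1"
    using sin_cos_squared_add[of "of_int k * pi + pi / 2"] by (simp add: s_def)
  then have "\<bar>s\<bar> = 1"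
    by (simp add: abs_square_eq_1)
  have "sine_bump (of_real (of_int k * pi + pi / 2)) = of_real (s * exp (s\<^sup>2 / 6))"
    unfolding sine_bump_def s_def sin_of_real of_real_mult[of "sin _"]
    by (simp flip: exp_of_real)
  then have "norm (of_real a * sine_bump (of_real (of_int k * pi + pi / 2))) = a * exp (1 / 6)"
    using assms \<open>\<bar>s\<bar> = 1\<close> \<open>s\<^sup>2 = 1\<close> by (simp add: norm_mult abs_mult)
  moreover have "1 * 1 \<le> a * exp (1 / 6)"
    using assms by (intro mult_mono) auto
  ultimately show ?thesis
    by simp
qed

section \<open>Spherical convergence and oscillation\<close>

lemma norm_stereo_diff_le_sph_dist: "norm (stereo p - stereo q) \<le> sph_dist p q"
proof -
  define t where "t = sph_dist p q"
  have abs: "\<bar>stereo p \<bullet> stereo q\<bar> \<le> 1"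
    using Cauchy_Schwarz_ineq2[of "stereo p" "stereo q"] by (simp add: norm_stereo)
  then have cos: "cos t = stereo p \<bullet> stereo q"
    unfolding t_def sph_dist_def by (simp add: cos_arccos_abs)
  have inner: "stereo u \<bullet> stereo u = 1" for u
    using norm_stereo[of u] by (simp add: norm_eq_1)
  have t: "0 \<le> t"
    using abs unfolding t_def sph_dist_def by (intro arccos_lbound) auto
  \<comment> \<open>A chord of the unit sphere that subtends the angle \<open>t\<close> has length 2
    sin(t/2), which is at most the arc length \<open>t\<close>.\<close>
  have "(norm (stereo p - stereo q))\<^sup>2 = 2 - 2 * cos t"
    by (simp add: cos inner inner_commute power2_norm_eq_inner algebra_simps)
  also have "\<dots> = (2 * sin (t / 2))\<^sup>2"
    using cos_double_sin[of "t / 2"] by (simp add: power_mult_distrib)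
  finally have "norm (stereo p - stereo q) = \<bar>2 * sin (t / 2)\<bar>"
    by (metis norm_ge_zero real_sqrt_abs real_sqrt_unique)
  also have "\<dots> \<le> t"
    using abs_sin_x_le_abs_x[of "t / 2"] t by simp
  finally show ?thesis
    by (simp add: t_def)
qed

text \<open>Passing from arcs to chords turns spherical convergence into uniform convergence in the
  normed space \<open>complex \<times> real\<close>, where continuity of uniform limits is
  available. One \<open>G\<close> serves all compact sets.\<close>

lemma sph_converges_on_imp_uniform_limit_stereo:
  assumes "sph_converges_on f U"
  obtains G where "\<And>K. compact K \<Longrightarrow> K \<subseteq> U \<Longrightarrow>
    uniform_limit K (\<lambda>n z. stereo (sph_val (f n) z)) G sequentially"
proof -
  obtain g where g: "\<And>K. compact K \<Longrightarrow> K \<subseteq> U \<Longrightarrow>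
      uniform_limit K (\<lambda>n z. sph_dist (sph_val (f n) z) (g z)) (\<lambda>_. 0) sequentially"
    using assms unfolding sph_converges_on_def by blast
  have "uniform_limit K (\<lambda>n z. stereo (sph_val (f n) z)) (\<lambda>z. stereo (g z)) sequentially"
    if "compact K" "K \<subseteq> U" for K
  proof (rule uniform_limitI)
    fix e :: real assume "e > 0"
    with g[OF that] show "\<forall>\<^sub>F n in sequentially.
        \<forall>z\<in>K. dist (stereo (sph_val (f n) z)) (stereo (g z)) < e"
      using norm_stereo_diff_le_sph_dist
      by (auto dest!: uniform_limitD elim!: eventually_mono simp: dist_norm)
        (smt (verit) norm_stereo_diff_le_sph_dist)
  qed
  then show thesis
    by (rule that)
qed

lemma snd_stereo_Fin_nonneg:
  assumes "norm w \<ge> 1"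
  shows "snd (stereo (Fin w)) \<ge> 0"
  using assms by (simp add: zero_le_divide_iff)

lemma continuous_on_stereo_Fin:
  assumes "continuous_on S f"
  shows "continuous_on S (\<lambda>z. stereo (Fin (f z)))"
proof -
  have "1 + (norm w)\<^sup>2 \<noteq> 0" "(norm w)\<^sup>2 + 1 \<noteq> 0" for w :: complex
    by (smt (verit) zero_le_power2)+
  then show ?thesis
    unfolding stereo.simps by (intro continuous_intros assms) auto
qed

lemma uniform_limit_tendsto_moving_point:
  fixes F :: "nat \<Rightarrow> 'a::metric_space \<Rightarrow> 'b::metric_space"
  assumes lim: "uniform_limit K F G sequentially"
    and cont: "continuous_on K G"
    and x: "x \<longlonglongrightarrow> z" "\<forall>\<^sub>F n in sequentially. x n \<in> K" "z \<in> K"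
  shows "(\<lambda>n. F n (x n)) \<longlonglongrightarrow> G z"
proof (rule tendstoI)
  fix e :: real assume "e > 0"
  have "(\<lambda>n. G (x n)) \<longlonglongrightarrow> G z"
    using continuous_on_tendsto_compose[OF cont x(1,3,2)] .
  then have "\<forall>\<^sub>F n in sequentially. dist (G (x n)) (G z) < e / 2"
    using \<open>e > 0\<close> by (intro tendstoD) auto
  moreover have "\<forall>\<^sub>F n in sequentially. \<forall>w\<in>K. dist (F n w) (G w) < e / 2"
    using \<open>e > 0\<close> by (intro uniform_limitD[OF lim]) auto
  ultimately show "\<forall>\<^sub>F n in sequentially. dist (F n (x n)) (G z) < e"
    using x(2)
  proof eventually_elim
    case (elim n)
    then show ?case
      using dist_triangle[of "F n (x n)" "G z" "G (x n)"] by force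
  qed
qed

text \<open>The images of the values at \<open>x n\<close> are the south pole, those of the values
  at \<open>y n\<close> lie in the closed upper hemisphere. Uniform convergence to a continuous
  limit would send both to the same point \<open>G z\<close>.\<close>

lemma not_sph_converges_on_oscillating:
  assumes conv: "sph_converges_on f U" and "open U" "z \<in> U"
    and hol: "\<And>n. f n holomorphic_on U"
    and x: "x \<longlonglongrightarrow> z" "\<And>n. f n (x n) = 0"
    and y: "y \<longlonglongrightarrow> z" "\<And>n. norm (f n (y n)) \<ge> 1"
  shows False
proof -
  obtain e where "e > 0" and e: "cball z e \<subseteq> U"
    using \<open>open U\<close> \<open>z \<in> U\<close> open_contains_cball by blast
  obtain G where G: "\<And>K. compact K \<Longrightarrow> K \<subseteq> U \<Longrightarrow>
      uniform_limit K (\<lambda>n z. stereo (sph_val (f n) z)) G sequentially"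
    using sph_converges_on_imp_uniform_limit_stereo[OF conv] by blast
  have val: "sph_val (f n) w = Fin (f n w)" if "w \<in> U" for n w
    using not_is_pole_holomorphic[OF \<open>open U\<close> that hol] by (simp add: sph_val_def)
  have lim: "uniform_limit (cball z e) (\<lambda>n w. stereo (Fin (f n w))) G sequentially"
    using G[OF compact_cball e] e val
    by (subst (asm) uniform_limit_cong'[of _ _ "\<lambda>n w. stereo (Fin (f n w))" _ G]) auto
  have "continuous_on (cball z e) (\<lambda>w. stereo (Fin (f n w)))" for n
    using hol e by (intro continuous_on_stereo_Fin holomorphic_on_imp_continuous_on)
      (auto intro: holomorphic_on_subset)
  then have cont: "continuous_on (cball z e) G"
    by (intro uniform_limit_theorem[OF _ lim]) auto
  have inK: "\<forall>\<^sub>F n in sequentially. u n \<in> cball z e" if "u \<longlonglongrightarrow> z" for u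
    using tendstoD[OF that \<open>e > 0\<close>] by eventually_elim (simp add: dist_commute)
  have *: "(\<lambda>n. snd (stereo (Fin (f n (u n))))) \<longlonglongrightarrow> snd (G z)" if "u \<longlonglongrightarrow> z" for u
    using \<open>e > 0\<close>
    by (intro tendsto_snd uniform_limit_tendsto_moving_point[OF lim cont that inK[OF that]]) auto
  \<comment> \<open>The last coordinate is the height on the sphere: it is -1 at the image of 0 and
    nonnegative at images of points of modulus at least 1.\<close>
  have "snd (G z) = -1"
    using *[OF x(1)] x(2) by (simp add: LIMSEQ_const_iff)
  moreover have "snd (G z) \<ge> 0"
    using *[OF y(1)] snd_stereo_Fin_nonneg[OF y(2)] by (intro LIMSEQ_le_const) auto
  ultimately show False
    by simp
qed

section \<open>Failure of quasi-normality at real points\<close>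

text \<open>Rounding down to a multiple of \<open>c / m n\<close> moves \<open>t\<close> by at most
  \<open>c / m n\<close>, which tends to 0.\<close>

lemma tendsto_floor_mult_div:
  fixes m :: "nat \<Rightarrow> nat"
  assumes "filterlim m at_top sequentially" "c > 0"
  shows "(\<lambda>n. real_of_int \<lfloor>real (m n) * t / c\<rfloor> * c / real (m n)) \<longlonglongrightarrow> t"
proof (rule tendsto_sandwich)
  have pos: "\<forall>\<^sub>F n in sequentially. m n > 0"
    using assms(1) by (auto simp: filterlim_at_top Suc_le_eq dest: spec[of _ "Suc 0"])
  have m: "filterlim (\<lambda>n. real (m n)) at_top sequentially"
    by (rule filterlim_compose[OF filterlim_real_sequentially assms(1)])
  have "(\<lambda>n. t - c / real (m n)) \<longlonglongrightarrow> t - 0"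
    by (intro tendsto_intros real_tendsto_divide_at_top[OF tendsto_const m])
  then show "(\<lambda>n. t - c / real (m n)) \<longlonglongrightarrow> t"
    by simp
  have floor: "real (m n) * t - c \<le> real_of_int \<lfloor>real (m n) * t / c\<rfloor> * c"
      "real_of_int \<lfloor>real (m n) * t / c\<rfloor> * c \<le> real (m n) * t" for n
  proof -
    have "real (m n) * t / c - 1 \<le> real_of_int \<lfloor>real (m n) * t / c\<rfloor>"
      by linarith
    from mult_right_mono[OF this, of c]
    show "real (m n) * t - c \<le> real_of_int \<lfloor>real (m n) * t / c\<rfloor> * c"
      using \<open>c > 0\<close> by (simp add: algebra_simps)
    show "real_of_int \<lfloor>real (m n) * t / c\<rfloor> * c \<le> real (m n) * t"
      using mult_right_mono[OF of_int_floor_le[of "real (m n) * t / c"], of c] \<open>c > 0\<close> by simp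
  qed
  show "\<forall>\<^sub>F n in sequentially. t - c / real (m n) \<le> real_of_int \<lfloor>real (m n) * t / c\<rfloor> * c / real (m n)"
    using pos
  proof eventually_elim
    case (elim n)
    then show ?case
      using divide_right_mono[OF floor(1)[of n], of "real (m n)"] by (simp add: diff_divide_distrib)
  qed
  show "\<forall>\<^sub>F n in sequentially. real_of_int \<lfloor>real (m n) * t / c\<rfloor> * c / real (m n) \<le> t"
    using pos
  proof eventually_elim
    case (elim n)
    then show ?case
      using floor(2)[of n] by (simp add: field_simps)
  qed
qed simp

text \<open>A set without limit points in \<open>D\<close> is relatively closed in
  \<open>D\<close>.\<close>

lemma open_diff_if_no_islimpt:
  assumes "open D" "\<forall>z\<in>D. \<not> z islimpt E"
  shows "open (D - E)"
proof -
  have "D - E = D - closure E"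
    using assms(2) by (auto simp: closure_def)
  then show ?thesis
    using assms(1) by (simp add: open_Diff)
qed

lemma not_quasi_normal_scaled_sine_bump:
  fixes a :: "nat \<Rightarrow> real"
  assumes "\<And>n. a n \<ge> 1" "open D" "of_real t0 \<in> D"
  shows "\<not> quasi_normal ((\<lambda>n z. of_real (a n) * sine_bump (of_nat n * z)) ` {1..}) D"
proof
  define f where "f = (\<lambda>n z. of_real (a n) * sine_bump (of_nat n * z))"
  assume "quasi_normal ((\<lambda>n z. of_real (a n) * sine_bump (of_nat n * z)) ` {1..}) D"
  then have "quasi_normal (f ` {1..}) D"
    by (simp only: f_def)
  \<comment> \<open>The family starts at index 1, so the test sequence is shifted by
    \<open>Suc\<close>; its subsequence along \<open>r\<close> has frequencies
    \<open>Suc (r n)\<close>, later called \<open>m n\<close>.\<close>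
  moreover have "range (f \<circ> Suc) \<subseteq> f ` {1..}"
    by auto
  ultimately obtain r E where r: "strict_mono r"
    and noacc: "\<forall>z\<in>D. \<not> z islimpt E"
    and conv: "sph_converges_on (f \<circ> Suc \<circ> r) (D - E)"
    unfolding quasi_normal_def by blast
  define U where "U = D - E"
  have "open U"
    unfolding U_def using assms(2) noacc by (rule open_diff_if_no_islimpt)
  \<comment> \<open>The point \<open>t0\<close> may itself lie in \<open>E\<close>, but
    \<open>E\<close> misses a punctured disc around it, so a small shift along the real axis stays
    in \<open>D\<close> and leaves \<open>E\<close>.\<close>
  obtain t where t: "complex_of_real t \<in> U"
  proof -
    have "\<not> complex_of_real t0 islimpt E"
      using noacc assms(3) by simp
    then obtain d where "d > 0"
      and d: "\<And>w. w \<in> E \<Longrightarrow> w \<noteq> of_real t0 \<Longrightarrow> d \<le> dist w (of_real t0)"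
      by (auto simp: islimpt_approachable not_less)
    obtain e where "e > 0" and e: "ball (complex_of_real t0) e \<subseteq> D"
      using assms(2,3) open_contains_ball by blast
    define h where "h = min d e / 2"
    have h: "0 < h" "h < d" "h < e"
      using \<open>d > 0\<close> \<open>e > 0\<close> by (auto simp: h_def)
    have dist: "dist (complex_of_real (t0 + h)) (of_real t0) = h"
      using h by (simp add: dist_norm)
    then have "complex_of_real (t0 + h) \<in> D"
      using e h by (simp add: subset_iff dist_commute)
    moreover have "complex_of_real (t0 + h) \<notin> E"
      using d[of "complex_of_real (t0 + h)"] dist h by force
    ultimately have "complex_of_real (t0 + h) \<in> U"
      by (simp add: U_def)
    then show thesis
      by (rule that)
  qed
  define m where "m n = Suc (r n)" for n
  have m: "filterlim m at_top sequentially"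
    unfolding m_def by (rule filterlim_compose[OF filterlim_Suc filterlim_subseq[OF r]])
  have m_real: "filterlim (\<lambda>n. real (m n)) at_top sequentially"
    by (rule filterlim_compose[OF filterlim_real_sequentially m])
  \<comment> \<open>After scaling by \<open>m n\<close>, the point \<open>x n\<close> is the last
    multiple of \<pi> not beyond \<open>m n * t\<close>, a zero of the sine, and \<open>y n\<close>
    lies a quarter period further, where the sine has modulus 1.\<close>
  define k where "k n = \<lfloor>real (m n) * t / pi\<rfloor>" for n
  define x where "x n = of_int (k n) * pi / real (m n)" for n
  define y where "y n = x n + (pi / 2) / real (m n)" for n
  have x: "x \<longlonglongrightarrow> t"
    unfolding x_def k_def using tendsto_floor_mult_div[OF m pi_gt_zero] .
  have "(\<lambda>n. (pi / 2) / real (m n)) \<longlonglongrightarrow> 0"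
    by (intro real_tendsto_divide_at_top[OF tendsto_const m_real])
  then have y: "y \<longlonglongrightarrow> t"
    unfolding y_def using tendsto_add[OF x] by fastforce
  have mx: "of_nat (m n) * complex_of_real (x n) = of_real (of_int (k n) * pi)" for n
    by (simp add: x_def m_def del: of_nat_Suc)
  have "real (m n) * y n = of_int (k n) * pi + pi / 2" for n
    by (simp add: y_def x_def m_def distrib_left del: of_nat_Suc)
  then have my: "of_nat (m n) * complex_of_real (y n) = of_real (of_int (k n) * pi + pi / 2)" for n
    by (metis of_real_mult of_real_of_nat_eq)
  show False
  proof (rule not_sph_converges_on_oscillating)
    show "sph_converges_on (f \<circ> Suc \<circ> r) U"
      using conv by (simp only: U_def)
    show "(f \<circ> Suc \<circ> r) n holomorphic_on U" for n
      unfolding f_def comp_def by (rule holomorphic_scaled_sine_bump)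
    show "(\<lambda>n. complex_of_real (x n)) \<longlonglongrightarrow> of_real t" "(\<lambda>n. complex_of_real (y n)) \<longlonglongrightarrow> of_real t"
      using x y by (simp_all add: tendsto_of_real)
    have f_eq: "(f \<circ> Suc \<circ> r) n w = of_real (a (m n)) * sine_bump (of_nat (m n) * w)" for n w
      by (simp only: f_def comp_def m_def)
    show "(f \<circ> Suc \<circ> r) n (complex_of_real (x n)) = 0" for n
      unfolding f_eq mx by (rule scaled_sine_bump_zero)
    show "1 \<le> norm ((f \<circ> Suc \<circ> r) n (complex_of_real (y n)))" for n
      unfolding f_eq my by (rule norm_scaled_sine_bump_ge_1[OF assms(1)])
  qed (fact \<open>open U\<close> t)+
qed

theorem mainTheorem1:
  "\<exists>f :: nat \<Rightarrow> complex \<Rightarrow> complex.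
     (\<forall>n\<ge>1. f n holomorphic_on ball 0 2) \<and>
     (\<forall>n\<ge>1. \<forall>z\<in>ball 0 2. norm ((deriv ^^ 2) (f n) z) / (1 + norm (f n z) ^ 3) \<le> 1) \<and>
     \<not> quasi_normal (f ` {1..}) (ball 0 2)"
proof -
  obtain a :: "nat \<Rightarrow> real" where a: "\<And>n. a n \<ge> 1"
    and bound: "\<And>n z. z \<in> ball 0 2 \<Longrightarrow>
      norm ((of_nat n)\<^sup>2 * sine_bump_cofactor (of_nat n * z)) \<le> (a n)\<^sup>2"
    using ex_sine_bump_scale[of 2 "of_nat _"] by metis
  define f where "f = (\<lambda>n z. of_real (a n) * sine_bump (of_nat n * z))"
  have "norm ((deriv ^^ 2) (f n) z) / (1 + norm (f n z) ^ 3) \<le> 1" if "z \<in> ball 0 2" for n z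
  proof -
    define b where "b = norm (sine_bump (of_nat n * z))"
    have "norm ((deriv ^^ 2) (f n) z)
        = a n * b ^ 3 * norm ((of_nat n)\<^sup>2 * sine_bump_cofactor (of_nat n * z))"
      using a[of n] unfolding f_def deriv2_scaled_sine_bump
      by (simp add: b_def norm_mult norm_power)
    \<comment> \<open>The factor \<open>(a n)\<^sup>2\<close> bounding the cofactor completes
      \<open>a n\<close> to its cube, which gives |f''| \<le> |f|^3, stronger than the required
      estimate.\<close>
    also have "\<dots> \<le> a n * b ^ 3 * (a n)\<^sup>2"
      using a[of n] by (intro mult_left_mono bound[OF that]) (auto simp: b_def)
    also have "\<dots> = norm (f n z) ^ 3"
      using a[of n]
      by (simp add: f_def b_def norm_mult power_mult_distrib power2_eq_square power3_eq_cube)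
    finally have "norm ((deriv ^^ 2) (f n) z) \<le> norm (f n z) ^ 3" .
    then show ?thesis
      by (simp add: divide_le_eq add_pos_nonneg)
  qed
  moreover have "f n holomorphic_on ball 0 2" for n
    unfolding f_def by (rule holomorphic_scaled_sine_bump)
  moreover have "\<not> quasi_normal (f ` {1..}) (ball 0 2)"
    unfolding f_def using a by (intro not_quasi_normal_scaled_sine_bump[of _ _ 0]) auto
  ultimately show ?thesis
    by blast
qed

end
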